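(* Let $d\in\mathbb{N}$ and let $K\subseteq\mathbb{R}^d$ be a non-empty compact set with $\alpha=\dim_A K$. Then there is a weak tangent $F\in\operatorname{Tan}(K)$ such that $\mathcal{H}^\alpha_\infty(F)\geq 1$.
   Context: $\mathbb{R}^d$ has the Euclidean metric and $B(x,r)$ is the closed ball with centre $x$ and radius $r$. For a bounded set $E$, $N_r(E)$ is the smallest number of closed balls of radius $r$ needed to cover $E$. The Assouad dimension of $K$ is $$\dim_A K=\inf\Bigl\{s:\exists C>0\ \forall\,0<r\leq R<1\ \forall x\in K,\ N_r(B(x,R)\cap K)\leq C\Bigl(\frac{R}{r}\Bigr)^s\Bigr\}.$$ A non-empty compact set $F\subset B(0,1)$ is a weak tangent of $K$, written $F\in\operatorname{Tan}(K)$, if there is a sequence of similarity maps $T_k\colon\mathbb{R}^d\to\mathbb{R}^d$ (i.e. $|T_k(x)-T_k(y)|=\lambda_k|x-y|$ for all $x,y$) with $0\in T_k(K)$ and similarity ratios $\lambda_k$ diverging to infinity such that $F=\lim_{k\to\infty}T_k(K)\cap B(0,1)$ in the Hausdorff metric on non-empty compact subsets of $B(0,1)$. The Hausdorff $\alpha$-content is $$\mathcal{H}^\alpha_\infty(E)=\inf\Bigl\{\sum_{i=1}^\infty(\operatorname{diam} U_i)^\alpha:E\subset\bigcup_{i=1}^\infty U_i,\ U_i\text{ open}\Bigr\}.$$ *)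

theory Defs
  imports "HOL-Analysis.Analysis"
begin

(* The centres are not required to lie in E.  The value is meaningful only if E has a finite
   cover by r-balls, e.g. if E is a bounded subset of a Euclidean space and r > 0. *)
definition covering_number :: "real \<Rightarrow> 'a::metric_space set \<Rightarrow> nat" where
  "covering_number r E =
     (LEAST n. \<exists>C. finite C \<and> card C = n \<and> E \<subseteq> (\<Union>x\<in>C. cball x r))"

(* A real infimum: for non-empty K in a Euclidean space the set of exponents is non-empty and
   bounded below by 0. *)
definition assouad_dim :: "'a::metric_space set \<Rightarrow> real" where
  "assouad_dim K =
     Inf {s. \<exists>C>0. \<forall>r R. 0 < r \<and> r \<le> R \<and> R < 1 \<longrightarrow>
               (\<forall>x\<in>K. real (covering_number r (cball x R \<inter> K)) \<le> C * (R / r) powr s)}"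

definition similarity_map :: "real \<Rightarrow> ('a::metric_space \<Rightarrow> 'a) \<Rightarrow> bool" where
  "similarity_map l T \<longleftrightarrow> l > 0 \<and> (\<forall>x y. dist (T x) (T y) = l * dist x y)"

(* The Hausdorff metric; meaningful for non-empty bounded sets only. *)
definition hausdorff_dist :: "'a::metric_space set \<Rightarrow> 'a set \<Rightarrow> real" where
  "hausdorff_dist A B = max (SUP a\<in>A. infdist a B) (SUP b\<in>B. infdist b A)"

definition weak_tangents :: "'a::real_normed_vector set \<Rightarrow> 'a set set" where
  "weak_tangents K =
     {F. F \<noteq> {} \<and> compact F \<and> F \<subseteq> cball 0 1 \<and>
         (\<exists>(T :: nat \<Rightarrow> 'a \<Rightarrow> 'a) l.
            (\<forall>k. similarity_map (l k) (T k) \<and> 0 \<in> T k ` K) \<and>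
            filterlim l at_top sequentially \<and>
            (\<lambda>k. hausdorff_dist (T k ` K \<inter> cball 0 1) F) \<longlonglongrightarrow> 0)}"

(* (diam U)^a with values in [0, \<infinity>].  The library's real-valued diameter is unspecified on
   unbounded sets, so these are treated separately, with \<infinity>^0 = 1.  Since 0 powr 0 = 0,
   the empty set contributes 0 for every a, so finite covers are also allowed when a = 0. *)
definition diam_powr :: "real \<Rightarrow> 'a::metric_space set \<Rightarrow> ennreal" where
  "diam_powr a U =
     (if bounded U then ennreal (diameter U powr a) else if a = 0 then 1 else \<infinity>)"

definition hausdorff_content :: "real \<Rightarrow> 'a::metric_space set \<Rightarrow> ennreal" where
  "hausdorff_content a E =
     Inf {(\<Sum>i. diam_powr a (U i)) | U :: nat \<Rightarrow> 'a set.
            (\<forall>i. open (U i)) \<and> E \<subseteq> (\<Union>i. U i)}"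

end

(* Suppose that every weak tangent has content less than 1.  A limit F of blow-ups then has a finite
   open cover with sum of (diam U_i)^s < 1 for some s < alpha as well, by continuity in s, and this
   cover also covers the blow-ups close to F.  A set U_i that meets the blow-up lies in a ball of
   radius diam U_i < 1 centred at a point of it, so at all small scales a ball of radius R in K is
   covered by balls of radii rho_i R centred in K, with rho_i < 1 bounded away from 0 and 1 and the
   sum of the rho_i^s at most 1.  Iterating gives N_r <= C (R/r)^s, hence dim_A K <= s < alpha.
   Blaschke selection makes the cover uniform over all small balls. *)
theory Submission
  imports Defs "HOL-Complex_Analysis.Great_Picard"
begin

section \<open>Compactness for the Hausdorff metric\<close>

text \<open>A real \<open>SUP\<close> dominates its members only if the family is bounded above,
  hence \<open>bounded A\<close>. This one-sided estimate later places blow-ups inside a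
  neighbourhood of their limit.\<close>

lemma infdist_le_hausdorff_dist:
  assumes "a \<in> A" "bounded A" "B \<noteq> {}"
  shows "infdist a B \<le> hausdorff_dist A B"
proof -
  obtain b where b: "b \<in> B" using assms by blast
  obtain e where e: "\<And>y. y \<in> A \<Longrightarrow> dist b y \<le> e"
    using \<open>bounded A\<close> by (metis bounded_any_center)
  have "bdd_above ((\<lambda>a. infdist a B) ` A)"
  proof (rule bdd_aboveI2)
    fix y assume "y \<in> A"
    show "infdist y B \<le> e"
      using infdist_le[OF b, of y] e[OF \<open>y \<in> A\<close>] by (simp add: dist_commute)
  qed
  then have "infdist a B \<le> (SUP a\<in>A. infdist a B)"
    by (rule cSUP_upper[OF assms(1)])
  then show ?thesis unfolding hausdorff_dist_def by linarith
qed

lemma hausdorff_dist_le: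
  assumes "A \<noteq> {}" "B \<noteq> {}" "\<And>a. a \<in> A \<Longrightarrow> infdist a B \<le> e" "\<And>b. b \<in> B \<Longrightarrow> infdist b A \<le> e"
  shows "hausdorff_dist A B \<le> e"
  unfolding hausdorff_dist_def using assms by (auto intro!: cSUP_least)

lemma hausdorff_dist_nonneg:
  assumes "A \<noteq> {}" "bounded A" "B \<noteq> {}"
  shows "0 \<le> hausdorff_dist A B"
  using assms infdist_le_hausdorff_dist[of _ A B] infdist_nonneg by (metis ex_in_conv order_trans)

text \<open>Blaschke selection: the distance functions of the sets are 1-Lipschitz, so by Arzela--Ascoli
  they have a uniformly convergent subsequence, and its limit is the distance function of its own
  zero set.\<close>

lemma hausdorff_convergent_subsequence:
  fixes A :: "nat \<Rightarrow> 'a::euclidean_space set"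
  assumes S: "compact S" and A: "\<And>n. compact (A n)" "\<And>n. A n \<noteq> {}" "\<And>n. A n \<subseteq> S"
  obtains F k where "F \<noteq> {}" "compact F" "F \<subseteq> S" "strict_mono (k :: nat \<Rightarrow> nat)"
    "(\<lambda>n. hausdorff_dist (A (k n)) F) \<longlonglongrightarrow> 0"
proof -
  have bd: "norm (infdist x (A n)) \<le> diameter S" if "x \<in> S" for n x
  proof -
    obtain a where a: "a \<in> A n" using A(2) by blast
    have "infdist x (A n) \<le> dist x a" using a by (rule infdist_le)
    also have "\<dots> \<le> diameter S"
      using S a A(3) that by (intro diameter_bounded_bound compact_imp_bounded) auto
    finally show ?thesis by (simp add: infdist_nonneg)
  qed
  obtain g k where g: "continuous_on S g" and k: "strict_mono (k :: nat \<Rightarrow> nat)"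
    and lim: "\<And>e. 0 < e \<Longrightarrow> \<exists>N. \<forall>n x. n \<ge> N \<and> x \<in> S \<longrightarrow> norm (infdist x (A (k n)) - g x) < e"
  proof (rule Arzela_Ascoli[of S "\<lambda>n x. infdist x (A n)" "diameter S"])
    show "\<exists>d>0. \<forall>n y. y \<in> S \<and> norm (x - y) < d \<longrightarrow> norm (infdist x (A n) - infdist y (A n)) < e"
      if "0 < e" for x and e :: real
      using that
      by (intro exI[of _ e]) (auto simp: dist_norm intro: le_less_trans infdist_triangle_abs)
  qed (use S bd in auto)
  have ptw: "(\<lambda>n. infdist x (A (k n))) \<longlonglongrightarrow> g x" if "x \<in> S" for x
    using lim that unfolding LIMSEQ_iff by meson
  define F where "F = {x \<in> S. g x = 0}"
  have "closed F"
    unfolding F_def using g S by (intro continuous_closed_preimage_constant compact_imp_closed)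
  then have compF: "compact F"
    using compact_Int_closed[OF S, of F] by (simp add: F_def Int_absorb1 Collect_conj_eq)
  \<comment> \<open>The point of \<open>F\<close> is a cluster point of nearest points to
    \<open>x\<close> in the sets \<open>A (k n)\<close>: its distance from \<open>x\<close> is
    \<open>g x\<close>, and \<open>g\<close> vanishes there because it is a limit of points of these
    sets.\<close>
  have near: "\<exists>a\<in>F. dist x a = g x" if x: "x \<in> S" for x
  proof -
    have "\<exists>a. a \<in> A (k n) \<and> infdist x (A (k n)) = dist x a" for n
      using infdist_attains_inf[of "A (k n)" x] A compact_imp_closed by metis
    then obtain a where a: "\<And>n. a n \<in> A (k n)" "\<And>n. infdist x (A (k n)) = dist x (a n)"
      by metis
    have "\<forall>n. a n \<in> S" using a A(3) by blast
    then obtain l r where l: "l \<in> S" and r: "strict_mono (r :: nat \<Rightarrow> nat)" and al: "(a \<circ> r) \<longlonglongrightarrow> l"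
      using S unfolding compact_def by meson
    have "(\<lambda>n. dist x ((a \<circ> r) n)) \<longlonglongrightarrow> dist x l" using al by (intro tendsto_intros)
    moreover have "((\<lambda>n. infdist x (A (k n))) \<circ> r) \<longlonglongrightarrow> g x"
      using ptw[OF x] r by (rule LIMSEQ_subseq_LIMSEQ)
    ultimately have 1: "dist x l = g x"
      by (metis (no_types, lifting) LIMSEQ_unique a(2) comp_apply ext)
    have "((\<lambda>n. infdist l (A (k n))) \<circ> r) \<longlonglongrightarrow> g l"
      using ptw[OF l] r by (rule LIMSEQ_subseq_LIMSEQ)
    moreover have "((\<lambda>n. infdist l (A (k n))) \<circ> r) \<longlonglongrightarrow> 0"
    proof (rule tendsto_sandwich[of "\<lambda>_. 0" _ _ "\<lambda>n. dist l ((a \<circ> r) n)"])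
      have "(\<lambda>n. dist l ((a \<circ> r) n)) \<longlonglongrightarrow> dist l l" using al by (intro tendsto_intros)
      then show "(\<lambda>n. dist l ((a \<circ> r) n)) \<longlonglongrightarrow> 0" by simp
    qed (use a(1) in \<open>auto intro!: always_eventually infdist_le infdist_nonneg\<close>)
    ultimately have "g l = 0" by (rule LIMSEQ_unique)
    then show ?thesis using 1 l by (auto simp: F_def)
  qed
  have "F \<noteq> {}" using near A(2,3) by (metis empty_iff equals0I subsetD)
  \<comment> \<open>Both one-sided estimates come from the uniform convergence: on
    \<open>A (k n)\<close> the distance function is 0, so \<open>g\<close>, and by
    \<open>near\<close> the distance to \<open>F\<close>, is small; on \<open>F\<close> it is
    \<open>g\<close> that is 0.\<close>
  have close: "\<exists>N. \<forall>n\<ge>N. hausdorff_dist (A (k n)) F \<le> e" if "0 < e" for e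
  proof -
    obtain N where N: "\<And>n x. n \<ge> N \<Longrightarrow> x \<in> S \<Longrightarrow> norm (infdist x (A (k n)) - g x) < e"
      using lim[OF \<open>0 < e\<close>] by blast
    have "hausdorff_dist (A (k n)) F \<le> e" if "n \<ge> N" for n
    proof (rule hausdorff_dist_le)
      fix a assume a: "a \<in> A (k n)"
      then have "a \<in> S" using A(3) by blast
      then obtain b where "b \<in> F" "dist a b = g a" using near by blast
      then have "infdist a F \<le> g a" by (metis infdist_le)
      also have "g a \<le> e" using N[OF \<open>n \<ge> N\<close> \<open>a \<in> S\<close>] a by simp
      finally show "infdist a F \<le> e" .
    next
      fix b assume "b \<in> F"
      then show "infdist b (A (k n)) \<le> e"
        using N[OF \<open>n \<ge> N\<close>, of b] by (auto simp: F_def)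
    qed (use A \<open>F \<noteq> {}\<close> in auto)
    then show ?thesis by blast
  qed
  have "(\<lambda>n. hausdorff_dist (A (k n)) F) \<longlonglongrightarrow> 0"
  proof (rule LIMSEQ_I)
    fix e :: real assume "0 < e"
    then obtain N where N: "\<forall>n\<ge>N. hausdorff_dist (A (k n)) F \<le> e / 2"
      using close[of "e / 2"] by auto
    have "norm (hausdorff_dist (A (k n)) F - 0) < e" if "n \<ge> N" for n
    proof -
      have "0 \<le> hausdorff_dist (A (k n)) F"
        using A \<open>F \<noteq> {}\<close> by (intro hausdorff_dist_nonneg compact_imp_bounded)
      moreover have "hausdorff_dist (A (k n)) F \<le> e / 2" using N that by blast
      ultimately show ?thesis using \<open>0 < e\<close> by simp
    qed
    then show "\<exists>N. \<forall>n\<ge>N. norm (hausdorff_dist (A (k n)) F - 0) < e" by blast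
  qed
  moreover have "F \<subseteq> S" by (auto simp: F_def)
  ultimately show thesis using that \<open>F \<noteq> {}\<close> compF k by blast
qed

text \<open>Magnifying by \<open>1 / R n\<close> about \<open>x n\<close> sends \<open>x n\<close>
  to 0, so the blow-ups within the unit ball are non-empty and compact, and selection applies. Since
  \<open>R\<close> tends to 0 the ratios diverge, and the selected subsequence of maps itself
  witnesses the tangent.\<close>

lemma weak_tangent_subsequence:
  fixes K :: "'a::euclidean_space set"
  assumes K: "compact K" and x: "\<And>n. x n \<in> K" and R: "\<And>n. 0 < R n" "R \<longlonglongrightarrow> 0"
  obtains F k where "F \<in> weak_tangents K" "strict_mono (k :: nat \<Rightarrow> nat)"
    "(\<lambda>n. hausdorff_dist ((\<lambda>y. (1 / R (k n)) *\<^sub>R (y - x (k n))) ` K \<inter> cball 0 1) F) \<longlonglongrightarrow> 0"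
proof -
  define T where "T = (\<lambda>n y. (1 / R n) *\<^sub>R (y - x n))"
  have zero: "0 \<in> T n ` K" for n
    using x[of n] by (auto simp: T_def image_iff intro!: bexI[of _ "x n"])
  have comp: "compact (T n ` K \<inter> cball 0 1)" for n
    unfolding T_def using K
    by (intro compact_Int_closed compact_continuous_image continuous_intros) auto
  obtain F k where F: "F \<noteq> {}" "compact F" "F \<subseteq> cball 0 1" and k: "strict_mono (k :: nat \<Rightarrow> nat)"
    and lim: "(\<lambda>n. hausdorff_dist (T (k n) ` K \<inter> cball 0 1) F) \<longlonglongrightarrow> 0"
  proof (rule hausdorff_convergent_subsequence[of "cball 0 1" "\<lambda>n. T n ` K \<inter> cball 0 1"])
    show "T n ` K \<inter> cball 0 1 \<noteq> {}" for n using zero[of n] by force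
  qed (use comp in auto)
  have "filterlim (\<lambda>n. inverse (R n)) at_top sequentially"
    using R by (intro filterlim_inverse_at_top) auto
  then have "filterlim (\<lambda>n. 1 / R (k n)) at_top sequentially"
    using filterlim_compose[OF _ filterlim_subseq[OF k]] by (simp add: inverse_eq_divide)
  moreover have "similarity_map (1 / R n) (T n)" for n
    using R(1)[of n]
    by (auto simp: similarity_map_def T_def dist_norm simp flip: scaleR_diff_right)
  ultimately have "F \<in> weak_tangents K"
    unfolding weak_tangents_def using F zero lim
    by (auto intro!: exI[of _ "\<lambda>n. T (k n)"] exI[of _ "\<lambda>n. 1 / R (k n)"])
  then show thesis using that k lim unfolding T_def by blast
qed

section \<open>Bounding the Assouad dimension by self-improving covers\<close>

lemma covering_number_le:
  assumes "finite C" "E \<subseteq> (\<Union>x\<in>C. cball x r)"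
  shows "covering_number r E \<le> card C"
  unfolding covering_number_def using assms by (intro Least_le) blast

text \<open>Total boundedness of \<open>K\<close> supplies a finite cover, so the
  \<open>LEAST\<close> is attained by an actual cover, and this cannot be empty.\<close>

lemma covering_number_pos:
  fixes E :: "'a::metric_space set"
  assumes "compact K" "E \<subseteq> K" "E \<noteq> {}" "0 < r"
  shows "1 \<le> covering_number r E"
proof -
  obtain C where "finite C" "K \<subseteq> (\<Union>x\<in>C. ball x r)"
    using assms by (metis compact_eq_totally_bounded)
  then have "\<exists>n C. finite C \<and> card C = n \<and> E \<subseteq> (\<Union>x\<in>C. cball x r)"
    using assms(2) by (intro exI[of _ "card C"] exI[of _ C]) force
  from LeastI_ex[OF this] obtain D where
    "finite D" "card D = covering_number r E" "E \<subseteq> (\<Union>x\<in>D. cball x r)"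
    unfolding covering_number_def by blast
  then show ?thesis using \<open>E \<noteq> {}\<close>
    by (metis SUP_empty card_0_eq less_one linorder_not_le subset_empty)
qed

definition assouad_exponent :: "'a::metric_space set \<Rightarrow> real \<Rightarrow> bool" where
  "assouad_exponent K s \<longleftrightarrow> (\<exists>C>0. \<forall>r R. 0 < r \<and> r \<le> R \<and> R < 1 \<longrightarrow>
     (\<forall>x\<in>K. real (covering_number r (cball x R \<inter> K)) \<le> C * (R / r) powr s))"

lemma assouad_dim_alt: "assouad_dim K = Inf {s. assouad_exponent K s}"
  by (simp add: assouad_dim_def assouad_exponent_def)

text \<open>For negative \<open>s\<close> the bound \<open>C * (R / r) powr s\<close> drops below 1
  once \<open>R / r\<close> is large, while covering numbers of non-empty sets are at least 1. This
  bounds the set of exponents below, so that the real \<open>Inf\<close> is meaningful.\<close>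

lemma assouad_exponent_nonneg:
  assumes "compact K" "K \<noteq> {}" "assouad_exponent K s"
  shows "0 \<le> s"
proof (rule ccontr)
  assume "\<not> 0 \<le> s"
  then have s: "s < 0" by simp
  obtain C where "C > 0" and C: "\<And>r R x. 0 < r \<Longrightarrow> r \<le> R \<Longrightarrow> R < 1 \<Longrightarrow> x \<in> K \<Longrightarrow>
      real (covering_number r (cball x R \<inter> K)) \<le> C * (R / r) powr s"
    using assms(3) unfolding assouad_exponent_def by meson
  obtain x where x: "x \<in> K" using assms by blast
  \<comment> \<open>The ratio solving \<open>t powr s = 1 / (C + 1)\<close>; it is realised by
    \<open>R = 1 / 2\<close>, which respects \<open>R < 1\<close>, and
    \<open>r = 1 / (2 * t)\<close>.\<close>
  define t where "t = (C + 1) powr (- 1 / s)"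
  have t1: "1 \<le> t" unfolding t_def using s \<open>C > 0\<close> by (intro ge_one_powr_ge_zero) auto
  have ts: "t powr s = 1 / (C + 1)"
    unfolding t_def powr_powr using s \<open>C > 0\<close> by (simp add: powr_minus_divide)
  have "1 \<le> covering_number (1 / (2 * t)) (cball x (1 / 2) \<inter> K)"
  proof (rule covering_number_pos[OF assms(1)])
    have "x \<in> cball x (1 / 2) \<inter> K" using x by simp
    then show "cball x (1 / 2) \<inter> K \<noteq> {}" by blast
  qed (use t1 in auto)
  then have "1 \<le> real (covering_number (1 / (2 * t)) (cball x (1 / 2) \<inter> K))" by simp
  also have "\<dots> \<le> C * ((1 / 2) / (1 / (2 * t))) powr s"
    using t1 x by (intro C) (auto simp: field_simps)
  also have "(1 / 2) / (1 / (2 * t)) = t" using t1 by simp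
  also have "C * t powr s < 1" using \<open>C > 0\<close> by (simp add: ts)
  finally show False by simp
qed

lemma assouad_dim_le:
  assumes "compact K" "K \<noteq> {}" "assouad_exponent K s"
  shows "assouad_dim K \<le> s"
  unfolding assouad_dim_alt using assms assouad_exponent_nonneg
  by (intro cInf_lower bdd_belowI[of _ 0]) auto

text \<open>The radii \<open>\<rho> i\<close> are relative to \<open>R\<close>, and indexing counts
  repeated balls with multiplicity. Centres in \<open>K\<close> allow the cover to be applied again
  to each of its balls; \<eta> < 1 makes this terminate, and \<delta> > 0 stops a single step from
  shrinking too far.\<close>

definition shrinking_cover ::
    "real \<Rightarrow> real \<Rightarrow> real \<Rightarrow> 'a::metric_space set \<Rightarrow> 'a \<Rightarrow> real \<Rightarrow> bool" where
  "shrinking_cover s \<delta> \<eta> K x R \<longleftrightarrow>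
     (\<exists>(I :: nat set) c \<rho>. finite I \<and> (\<forall>i\<in>I. c i \<in> K \<and> \<delta> \<le> \<rho> i \<and> \<rho> i \<le> \<eta>) \<and>
        (\<Sum>i\<in>I. \<rho> i powr s) \<le> 1 \<and> cball x R \<inter> K \<subseteq> (\<Union>i\<in>I. cball (c i) (\<rho> i * R)))"

text \<open>Balls are subdivided until their radius is at most \<open>r\<close>. The bound is the
  \<open>s\<close>-th power of the radius up to a fixed factor, and the
  \<open>\<rho> i powr s\<close> sum to at most 1, so it reproduces itself at each step with no
  constant growing with \<open>n\<close>.\<close>

lemma iterated_shrinking_cover:
  assumes cov: "\<And>x R. x \<in> K \<Longrightarrow> 0 < R \<Longrightarrow> R \<le> R0 \<Longrightarrow> shrinking_cover s \<delta> \<eta> K x R"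
    and "0 < \<delta>" "\<delta> \<le> 1" "0 \<le> s" "0 < r"
    and "x \<in> K" "\<delta> * r \<le> R" "R \<le> R0" "R * \<eta> ^ n \<le> r" "\<eta> < 1" "0 < \<eta>"
  shows "\<exists>C. finite C \<and> real (card C) \<le> (R / (\<delta> * r)) powr s \<and> cball x R \<inter> K \<subseteq> (\<Union>c\<in>C. cball c r)"
  using assms(6-)
proof (induction n arbitrary: x R)
  \<comment> \<open>At stopping, one ball is enough: \<open>\<delta> * r \<le> R\<close> makes the
    right-hand side at least 1.\<close>
  have *: "\<exists>C. finite C \<and> real (card C) \<le> (R / (\<delta> * r)) powr s \<and> cball x R \<inter> K \<subseteq> (\<Union>c\<in>C. cball c r)"
    if "\<delta> * r \<le> R" "R \<le> r" for x R
    using that \<open>0 < \<delta>\<close> \<open>0 < r\<close> \<open>0 \<le> s\<close>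
    by (intro exI[of _ "{x}"]) (auto intro!: ge_one_powr_ge_zero)
  {
    case 0
    then show ?case using * by simp
  next
    case (Suc n)
    show ?case
    proof (cases "R \<le> r")
      case True
      then show ?thesis using * Suc.prems by simp
    next
      case False
      then have "0 < R" using \<open>0 < r\<close> by linarith
      then obtain I :: "nat set" and c \<rho> where I: "finite I"
        and c: "\<And>i. i \<in> I \<Longrightarrow> c i \<in> K \<and> \<delta> \<le> \<rho> i \<and> \<rho> i \<le> \<eta>"
        and sum: "(\<Sum>i\<in>I. \<rho> i powr s) \<le> 1" and sub: "cball x R \<inter> K \<subseteq> (\<Union>i\<in>I. cball (c i) (\<rho> i * R))"
        using cov[of x R] Suc.prems unfolding shrinking_cover_def by auto
      have "\<exists>C. finite C \<and> real (card C) \<le> (\<rho> i * R / (\<delta> * r)) powr s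
          \<and> cball (c i) (\<rho> i * R) \<inter> K \<subseteq> (\<Union>c\<in>C. cball c r)" if i: "i \<in> I" for i
      proof (rule Suc.IH)
        \<comment> \<open>Only balls with \<open>R > r\<close> are subdivided, and one step shrinks
          the radius by a factor of at least \<delta>.\<close>
        show "\<delta> * r \<le> \<rho> i * R"
          using c[OF i] False \<open>0 < \<delta>\<close> \<open>0 < r\<close> by (intro mult_mono) auto
        have "\<rho> i * R \<le> 1 * R"
          using c[OF i] \<open>\<eta> < 1\<close> \<open>0 < R\<close> by (intro mult_right_mono) auto
        then show "\<rho> i * R \<le> R0" using Suc.prems by simp
        have "\<rho> i * R * \<eta> ^ n \<le> \<eta> * R * \<eta> ^ n"
          using c[OF i] \<open>0 < \<eta>\<close> \<open>0 < R\<close> by (intro mult_right_mono) auto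
        then show "\<rho> i * R * \<eta> ^ n \<le> r" using Suc.prems by (simp add: mult_ac)
      qed (use c[OF i] \<open>\<eta> < 1\<close> \<open>0 < \<eta>\<close> in auto)
      then obtain C where C: "\<And>i. i \<in> I \<Longrightarrow> finite (C i)"
        "\<And>i. i \<in> I \<Longrightarrow> real (card (C i)) \<le> (\<rho> i * R / (\<delta> * r)) powr s"
        "\<And>i. i \<in> I \<Longrightarrow> cball (c i) (\<rho> i * R) \<inter> K \<subseteq> (\<Union>c\<in>C i. cball c r)"
        by metis
      have "real (card (\<Union>i\<in>I. C i)) \<le> (\<Sum>i\<in>I. real (card (C i)))"
        using card_UN_le[OF I, of C] by (metis of_nat_mono of_nat_sum)
      also have "\<dots> \<le> (\<Sum>i\<in>I. (\<rho> i * R / (\<delta> * r)) powr s)"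
        using C(2) by (rule sum_mono)
      also have "\<dots> = (\<Sum>i\<in>I. \<rho> i powr s * (R / (\<delta> * r)) powr s)"
      proof (rule sum.cong[OF refl])
        fix i assume i: "i \<in> I"
        have "0 \<le> \<rho> i" using c[OF i] \<open>0 < \<delta>\<close> by linarith
        then show "(\<rho> i * R / (\<delta> * r)) powr s = \<rho> i powr s * (R / (\<delta> * r)) powr s"
          using \<open>0 < R\<close> \<open>0 < \<delta>\<close> \<open>0 < r\<close> by (metis powr_mult times_divide_eq_right)
      qed
      also have "\<dots> = (\<Sum>i\<in>I. \<rho> i powr s) * (R / (\<delta> * r)) powr s"
        by (simp add: sum_distrib_right)
      also have "\<dots> \<le> 1 * (R / (\<delta> * r)) powr s"
        using sum by (intro mult_right_mono) auto
      finally have "real (card (\<Union>i\<in>I. C i)) \<le> (R / (\<delta> * r)) powr s" by simp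
      moreover have "cball x R \<inter> K \<subseteq> (\<Union>c\<in>(\<Union>i\<in>I. C i). cball c r)"
      proof
        fix y assume y: "y \<in> cball x R \<inter> K"
        then obtain i where "i \<in> I" "y \<in> cball (c i) (\<rho> i * R) \<inter> K" using sub by blast
        then show "y \<in> (\<Union>c\<in>(\<Union>i\<in>I. C i). cball c r)" using C(3) by blast
      qed
      ultimately show ?thesis using I C(1) by (intro exI[of _ "\<Union>i\<in>I. C i"]) auto
    qed
  }
qed

text \<open>Iteration settles the scales up to \<open>R0\<close>. Larger balls are handled by
  finitely many balls of radius \<open>R0\<close> centred in \<open>K\<close>, and this number and
  the power of \<open>1 / \<delta>\<close> go into the constant.\<close>

lemma shrinking_cover_imp_assouad_exponent:
  fixes K :: "'a::metric_space set"
  assumes K: "compact K" and "0 < R0"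
    and cov: "\<And>x R. x \<in> K \<Longrightarrow> 0 < R \<Longrightarrow> R \<le> R0 \<Longrightarrow> shrinking_cover s \<delta> \<eta> K x R"
    and \<delta>: "0 < \<delta>" "\<delta> \<le> 1" and \<eta>: "0 < \<eta>" "\<eta> < 1" and s: "0 \<le> s"
  shows "assouad_exponent K s"
proof -
  have small: "\<exists>C. finite C \<and> real (card C) \<le> (R / (\<delta> * r)) powr s
      \<and> cball x R \<inter> K \<subseteq> (\<Union>c\<in>C. cball c r)"
    if "x \<in> K" "0 < r" "r \<le> R" "R \<le> R0" for x r R
  proof -
    have "0 < R" using that by linarith
    obtain n where "\<eta> ^ n < r / R"
      using real_arch_pow_inv[of "r / R" \<eta>] \<eta> \<open>0 < R\<close> \<open>0 < r\<close> by auto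
    then have n: "R * \<eta> ^ n \<le> r" using \<open>0 < R\<close> by (simp add: field_simps)
    have "\<delta> * r \<le> 1 * r" using that \<delta> by (intro mult_right_mono) auto
    then have "\<delta> * r \<le> R" using \<open>r \<le> R\<close> by linarith
    show ?thesis
      by (rule iterated_shrinking_cover
        [OF cov \<delta> s \<open>0 < r\<close> \<open>x \<in> K\<close> \<open>\<delta> * r \<le> R\<close> \<open>R \<le> R0\<close> n \<eta>(2,1)])
  qed
  obtain P where P: "P \<subseteq> K" "finite P" "K \<subseteq> (\<Union>x\<in>P. ball x R0)"
  proof (rule compactE_image[OF K, of K "\<lambda>x. ball x R0"])
    show "K \<subseteq> (\<Union>x\<in>K. ball x R0)" using \<open>0 < R0\<close> by auto
  qed auto
  \<comment> \<open>The factor \<open>card P + 1\<close> dominates both 1, for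
    \<open>R \<le> R0\<close>, and \<open>card P\<close>, for larger \<open>R\<close>; it stays
    positive even if \<open>P\<close> is empty.\<close>
  have bound: "real (covering_number r (cball x R \<inter> K)) \<le> (real (card P) + 1) * (R / (\<delta> * r)) powr s"
    if r: "0 < r" "r \<le> R" and x: "x \<in> K" for x r R
  proof -
    have "\<delta> * r \<le> 1 * r" using r \<delta> by (intro mult_right_mono) auto
    then have "\<delta> * r \<le> R" using r by linarith
    then have ge1: "1 \<le> (R / (\<delta> * r)) powr s"
      using r \<delta> s by (intro ge_one_powr_ge_zero) (auto simp: le_divide_eq_1)
    have "\<exists>C. finite C \<and> cball x R \<inter> K \<subseteq> (\<Union>c\<in>C. cball c r)
      \<and> real (card C) \<le> (real (card P) + 1) * (R / (\<delta> * r)) powr s"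
    proof (cases "R \<le> R0")
      case True
      obtain C where "finite C" "real (card C) \<le> 1 * (R / (\<delta> * r)) powr s"
        "cball x R \<inter> K \<subseteq> (\<Union>c\<in>C. cball c r)"
        using small[OF x r True] by auto
      moreover have "1 * (R / (\<delta> * r)) powr s \<le> (real (card P) + 1) * (R / (\<delta> * r)) powr s"
        by (intro mult_right_mono) auto
      ultimately show ?thesis by (meson order_trans)
    next
      case False
      show ?thesis
      proof (cases "r \<le> R0")
        case True
        have "\<forall>p\<in>P. \<exists>C. finite C \<and> real (card C) \<le> (R0 / (\<delta> * r)) powr s
            \<and> cball p R0 \<inter> K \<subseteq> (\<Union>c\<in>C. cball c r)"
          using small P(1) r True by blast
        then obtain C where C: "\<And>p. p \<in> P \<Longrightarrow> finite (C p)"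
          "\<And>p. p \<in> P \<Longrightarrow> real (card (C p)) \<le> (R0 / (\<delta> * r)) powr s"
          "\<And>p. p \<in> P \<Longrightarrow> cball p R0 \<inter> K \<subseteq> (\<Union>c\<in>C p. cball c r)"
          by metis
        have "real (card (\<Union>p\<in>P. C p)) \<le> (\<Sum>p\<in>P. real (card (C p)))"
          using card_UN_le[OF P(2), of C] by (metis of_nat_mono of_nat_sum)
        also have "\<dots> \<le> (\<Sum>p\<in>P. (R0 / (\<delta> * r)) powr s)"
          using C(2) by (rule sum_mono)
        also have "\<dots> = real (card P) * (R0 / (\<delta> * r)) powr s" by simp
        also have "\<dots> \<le> (real (card P) + 1) * (R / (\<delta> * r)) powr s"
          using False \<open>0 < R0\<close> \<delta> r s
          by (intro mult_mono powr_mono2 divide_right_mono) auto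
        finally have "real (card (\<Union>p\<in>P. C p)) \<le> (real (card P) + 1) * (R / (\<delta> * r)) powr s" .
        moreover have "K \<subseteq> (\<Union>c\<in>(\<Union>p\<in>P. C p). cball c r)"
        proof
          fix y assume "y \<in> K"
          then obtain p where "p \<in> P" "y \<in> cball p R0" using P(3) by (force simp: mem_ball)
          then show "y \<in> (\<Union>c\<in>(\<Union>p\<in>P. C p). cball c r)" using C(3) \<open>y \<in> K\<close> by blast
        qed
        ultimately show ?thesis using P(2) C(1) by (intro exI[of _ "\<Union>p\<in>P. C p"]) auto
      next
        case False
        have "cball x R \<inter> K \<subseteq> (\<Union>c\<in>P. cball c r)" using P(3) False by force
        moreover have "real (card P) * 1 \<le> (real (card P) + 1) * (R / (\<delta> * r)) powr s"
          using ge1 by (intro mult_mono) auto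
        ultimately show ?thesis using P(2) by (intro exI[of _ P]) auto
      qed
    qed
    then show ?thesis using covering_number_le by (metis of_nat_mono order_trans)
  qed
  have "real (covering_number r (cball x R \<inter> K)) \<le> ((real (card P) + 1) * (1 / \<delta>) powr s) * (R / r) powr s"
    if "0 < r" "r \<le> R" "x \<in> K" for x r R
  proof -
    have "(R / (\<delta> * r)) powr s = (1 / \<delta>) powr s * (R / r) powr s"
      using that \<delta> by (simp flip: powr_mult)
    then show ?thesis using bound[OF that] by (simp add: mult.assoc)
  qed
  then show ?thesis
    unfolding assouad_exponent_def using \<delta>
    by (intro exI[of _ "(real (card P) + 1) * (1 / \<delta>) powr s"]) (auto intro!: mult_pos_pos add_nonneg_pos)
qed

text \<open>Scaled copies of one finite cover of the unit ball give a shrinking cover at every point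
  and scale, for a crude exponent. Together with the lower bound 0 this keeps the infimum from being
  taken over the empty set.\<close>

lemma assouad_exponent_exists:
  fixes K :: "'a::euclidean_space set"
  assumes K: "compact K"
  shows "\<exists>s. assouad_exponent K s"
proof -
  \<comment> \<open>Moving the centres into \<open>K\<close> doubles the radii, so radius 1/4 yields
    the relative radius 1/2.\<close>
  obtain P :: "'a set" where P: "finite P" "cball 0 1 \<subseteq> (\<Union>x\<in>P. ball x (1 / 4))"
    using compact_cball[of "0 :: 'a" 1] unfolding compact_eq_totally_bounded
    by (metis zero_less_divide_1_iff zero_less_numeral)
  obtain h where h: "bij_betw h {0..<card P} P" using ex_bij_betw_nat_finite[OF P(1)] by blast
  \<comment> \<open>With \<rho> = 1/2 the sum is at most \<open>card P / 2 powr s\<close>, and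
    \<open>n < 2 ^ n\<close> makes \<open>s = card P\<close> sufficient.\<close>
  define s where "s = real (card P)"
  have "shrinking_cover s (1 / 2) (1 / 2) K x R" if "x \<in> K" "0 < R" for x R
  proof -
    define B where "B = (\<lambda>i. cball (x + R *\<^sub>R h i) (R / 4) \<inter> K)"
    define I where "I = {i \<in> {0..<card P}. B i \<noteq> {}}"
    have "\<forall>i\<in>I. \<exists>y. y \<in> B i" by (auto simp: I_def)
    then obtain c where c: "\<And>i. i \<in> I \<Longrightarrow> c i \<in> B i" by metis
    have "cball x R \<inter> K \<subseteq> (\<Union>i\<in>I. cball (c i) (1 / 2 * R))"
    proof
      fix y assume y: "y \<in> cball x R \<inter> K"
      have "(1 / R) *\<^sub>R (y - x) \<in> cball 0 1"
        using y \<open>0 < R\<close> by (auto simp: dist_norm norm_minus_commute)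
      then obtain i where i: "i < card P" "(1 / R) *\<^sub>R (y - x) \<in> ball (h i) (1 / 4)"
      proof -
        obtain p where "p \<in> P" "(1 / R) *\<^sub>R (y - x) \<in> ball p (1 / 4)"
          using P(2) \<open>(1 / R) *\<^sub>R (y - x) \<in> cball 0 1\<close> by blast
        moreover obtain i where "i < card P" "p = h i"
          using bij_betw_imp_surj_on[OF h] \<open>p \<in> P\<close> by (metis atLeastLessThan_iff imageE)
        ultimately show thesis using that by blast
      qed
      have "dist (x + R *\<^sub>R h i) y = R * dist (h i) ((1 / R) *\<^sub>R (y - x))"
      proof -
        have "x + R *\<^sub>R h i - y = R *\<^sub>R (h i - (1 / R) *\<^sub>R (y - x))"
          using \<open>0 < R\<close> by (simp add: algebra_simps)
        then show ?thesis using \<open>0 < R\<close> by (simp add: dist_norm)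
      qed
      also have "\<dots> \<le> R * (1 / 4)" using i \<open>0 < R\<close> by (intro mult_left_mono) auto
      finally have near: "dist (x + R *\<^sub>R h i) y \<le> R / 4" by simp
      then have "i \<in> I" using i y by (auto simp: I_def B_def)
      moreover have "dist (c i) y \<le> 1 / 2 * R"
        using c[OF \<open>i \<in> I\<close>] near dist_triangle2[of "c i" y "x + R *\<^sub>R h i"]
        by (simp add: B_def dist_commute)
      ultimately show "y \<in> (\<Union>i\<in>I. cball (c i) (1 / 2 * R))" by auto
    qed
    moreover have "(\<Sum>i\<in>I. (1 / 2) powr s) \<le> (1 :: real)"
    proof -
      have "I \<subseteq> {0..<card P}" by (auto simp: I_def)
      from card_mono[OF _ this] have "card I \<le> card P" by simp
      then have "real (card I) \<le> 2 ^ card P"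
        using of_nat_less_two_power[of "card P", where 'a = real] by linarith
      moreover have "(1 / 2 :: real) powr s = 1 / 2 ^ card P"
        by (simp add: s_def powr_realpow power_one_over)
      ultimately show ?thesis by simp
    qed
    ultimately show ?thesis
      unfolding shrinking_cover_def using c unfolding B_def
      by (intro exI[of _ I] exI[of _ c] exI[of _ "\<lambda>_. 1 / 2"]) (simp add: I_def)
  qed
  then have "assouad_exponent K s"
    by (intro shrinking_cover_imp_assouad_exponent[OF K, of 1 s "1 / 2" "1 / 2"]) (auto simp: s_def)
  then show ?thesis by blast
qed

lemma assouad_dim_nonneg:
  fixes K :: "'a::euclidean_space set"
  assumes "compact K" "K \<noteq> {}"
  shows "0 \<le> assouad_dim K"
  unfolding assouad_dim_alt using assms assouad_exponent_nonneg assouad_exponent_exists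
  by (intro cInf_greatest) auto

section \<open>Hausdorff content\<close>

text \<open>A ball of radius \<open>e\<close> has diameter \<open>2 * e\<close> in a Euclidean
  space. Positivity avoids the value \<open>0 powr 0 = 0\<close> and bounds the radii of finitely
  many cover sets away from 0.\<close>

lemma diameter_open_pos:
  fixes U :: "'a::euclidean_space set"
  assumes "open U" "bounded U" "U \<noteq> {}"
  shows "0 < diameter U"
proof -
  obtain x e where "0 < e" "ball x e \<subseteq> U"
    using assms by (metis equals0I open_contains_ball)
  then show ?thesis using diameter_subset[OF _ assms(2), of "ball x e"] by simp
qed

text \<open>For exponent 0 every non-empty open set contributes exactly 1, whether bounded or not,
  and a cover of \<open>F\<close> contains such a set.\<close>

lemma hausdorff_content_zero:
  fixes F :: "'a::euclidean_space set"
  assumes "F \<noteq> {}"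
  shows "1 \<le> hausdorff_content 0 F"
  unfolding hausdorff_content_def
proof (rule Inf_greatest, clarify)
  fix U :: "nat \<Rightarrow> 'a set" assume U: "\<forall>i. open (U i)" "F \<subseteq> (\<Union>i. U i)"
  then obtain i where "U i \<noteq> {}" using assms by blast
  then have "1 \<le> diam_powr 0 (U i)"
    using diameter_open_pos[of "U i"] U by (auto simp: diam_powr_def)
  also have "\<dots> \<le> (\<Sum>i. diam_powr 0 (U i))"
    using sum_le_suminf[of "\<lambda>i. diam_powr 0 (U i)" "{i}"] by simp
  finally show "1 \<le> (\<Sum>i. diam_powr 0 (U i))" .
qed

text \<open>For \<alpha> > 0 an unbounded set would cost \<infinity>, so all sets are bounded;
  compactness leaves finitely many. Finiteness is what later permits uniform bounds on the diameters
  and a change of exponent.\<close>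

lemma hausdorff_content_less_one_cover:
  fixes F :: "'a::euclidean_space set"
  assumes F: "compact F" and "0 < \<alpha>" and "hausdorff_content \<alpha> F < 1"
  obtains U and I :: "nat set" where "finite I"
    "\<And>i. i \<in> I \<Longrightarrow> open (U i) \<and> bounded (U i) \<and> U i \<noteq> {}"
    "F \<subseteq> (\<Union>i\<in>I. U i)" "(\<Sum>i\<in>I. diameter (U i) powr \<alpha>) < 1"
proof -
  obtain U :: "nat \<Rightarrow> 'a set" where U: "\<And>i. open (U i)" "F \<subseteq> (\<Union>i. U i)"
    and lt: "(\<Sum>i. diam_powr \<alpha> (U i)) < 1"
    using assms(3) unfolding hausdorff_content_def Inf_less_iff by blast
  have le: "(\<Sum>i\<in>I. diam_powr \<alpha> (U i)) < 1" if "finite I" for I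
    using le_less_trans[OF sum_le_suminf lt] that by simp
  have bounded: "bounded (U i)" for i
    using le[of "{i}"] \<open>0 < \<alpha>\<close> by (auto simp: diam_powr_def split: if_splits)
  obtain J where J: "finite J" "F \<subseteq> (\<Union>i\<in>J. U i)"
    using compactE_image[OF F, of UNIV U] U by metis
  define I where "I = {i \<in> J. U i \<noteq> {}}"
  have "finite I" "F \<subseteq> (\<Union>i\<in>I. U i)" using J unfolding I_def by auto blast
  moreover have "(\<Sum>i\<in>I. diameter (U i) powr \<alpha>) < 1"
    using le[OF \<open>finite I\<close>] bounded by (simp add: diam_powr_def sum_nonneg)
  moreover have "open (U i) \<and> bounded (U i) \<and> U i \<noteq> {}" if "i \<in> I" for i
    using that U(1) bounded by (simp add: I_def)
  ultimately show thesis using that by blast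
qed

section \<open>The tangent\<close>

text \<open>A set \<open>U i\<close> lies in the ball of radius \<open>diameter (U i)\<close> about
  any of its points, so recentring in \<open>K\<close> costs no constant factor; this is why the
  threshold for the content is exactly 1.\<close>

lemma shrinking_cover_of_blow_up:
  fixes K :: "'a::euclidean_space set"
  assumes "finite (I :: nat set)" "0 < R"
    and U: "\<And>i. i \<in> I \<Longrightarrow> bounded (U i) \<and> \<delta> \<le> diameter (U i) \<and> diameter (U i) \<le> \<eta>"
    and sum: "(\<Sum>i\<in>I. diameter (U i) powr s) \<le> 1"
    and sub: "(\<lambda>y. (1 / R) *\<^sub>R (y - x)) ` K \<inter> cball 0 1 \<subseteq> (\<Union>i\<in>I. U i)"
  shows "shrinking_cover s \<delta> \<eta> K x R"
proof -
  define T where "T = (\<lambda>y. (1 / R) *\<^sub>R (y - x))"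
  have T: "dist y z = R * dist (T y) (T z)" for y z
    using \<open>0 < R\<close> by (simp add: T_def dist_norm flip: scaleR_diff_right)
  \<comment> \<open>Sets missing the image of \<open>K\<close> offer no centre in \<open>K\<close>
    and are discarded.\<close>
  define J where "J = {i \<in> I. \<exists>y\<in>K. T y \<in> U i}"
  have "\<forall>i\<in>J. \<exists>y. y \<in> K \<and> T y \<in> U i" by (auto simp: J_def)
  then obtain c where c: "\<And>i. i \<in> J \<Longrightarrow> c i \<in> K \<and> T (c i) \<in> U i" by metis
  have "(\<Sum>i\<in>J. diameter (U i) powr s) \<le> (\<Sum>i\<in>I. diameter (U i) powr s)"
    using assms(1) by (intro sum_mono2) (auto simp: J_def)
  then have "(\<Sum>i\<in>J. diameter (U i) powr s) \<le> 1" using sum by linarith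
  moreover have "cball x R \<inter> K \<subseteq> (\<Union>i\<in>J. cball (c i) (diameter (U i) * R))"
  proof
    fix y assume y: "y \<in> cball x R \<inter> K"
    then have "T y \<in> cball 0 1"
      using \<open>0 < R\<close> by (auto simp: T_def dist_norm norm_minus_commute)
    then obtain i where i: "i \<in> I" "T y \<in> U i" using sub y unfolding T_def by blast
    then have "i \<in> J" using y by (auto simp: J_def)
    have "dist (T (c i)) (T y) \<le> diameter (U i)"
      using U[OF i(1)] c[OF \<open>i \<in> J\<close>] i(2) by (intro diameter_bounded_bound) auto
    then have "dist (c i) y \<le> diameter (U i) * R"
      using \<open>0 < R\<close> T[of "c i" y] by (simp add: mult.commute)
    then show "y \<in> (\<Union>i\<in>J. cball (c i) (diameter (U i) * R))" using \<open>i \<in> J\<close> by auto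
  qed
  moreover have "finite J" "J \<subseteq> I" using assms(1) by (auto simp: J_def)
  ultimately show ?thesis
    unfolding shrinking_cover_def using c U
    by (intro exI[of _ J] exI[of _ c] exI[of _ "\<lambda>i. diameter (U i)"]) auto
qed

text \<open>For each exponent \<open>s n\<close> below \<alpha> some small ball admits no shrinking
  cover. Blow-ups of these bad balls, with all parameters relaxing along one sequence, subconverge
  to the tangent sought.\<close>

lemma weak_tangent_large_content:
  fixes K :: "'a::euclidean_space set"
  assumes K: "compact K" "K \<noteq> {}" and pos: "0 < assouad_dim K"
  shows "\<exists>F\<in>weak_tangents K. 1 \<le> hausdorff_content (assouad_dim K) F"
proof -
  define \<alpha> where "\<alpha> = assouad_dim K"
  \<comment> \<open>The double \<open>Suc\<close> gives \<open>\<epsilon> n < 1\<close> already at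
    \<open>n = 0\<close>. The same \<open>\<epsilon> n\<close> controls the exponent, both bounds on
    the radii and the scale.\<close>
  define \<epsilon> where "\<epsilon> = (\<lambda>n. inverse (real (Suc (Suc n))))"
  have \<epsilon>: "0 < \<epsilon> n" "\<epsilon> n < 1" for n by (simp_all add: \<epsilon>_def field_simps)
  have \<epsilon>0: "\<epsilon> \<longlonglongrightarrow> 0" unfolding \<epsilon>_def by (rule LIMSEQ_Suc[OF LIMSEQ_inverse_real_of_nat])
  define s where "s = (\<lambda>n. \<alpha> * (1 - \<epsilon> n))"
  have "\<exists>x R. x \<in> K \<and> 0 < R \<and> R \<le> \<epsilon> n \<and> \<not> shrinking_cover (s n) (\<epsilon> n) (1 - \<epsilon> n) K x R" for n
  proof (rule ccontr)
    assume "\<not> ?thesis"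
    then have "assouad_exponent K (s n)"
      using \<epsilon>[of n] pos
      by (intro shrinking_cover_imp_assouad_exponent[OF K(1), of "\<epsilon> n" _ "\<epsilon> n" "1 - \<epsilon> n"])
        (auto simp: s_def \<alpha>_def)
    then have "\<alpha> \<le> s n" unfolding \<alpha>_def by (rule assouad_dim_le[OF K])
    then show False using pos \<epsilon>[of n] by (simp add: s_def \<alpha>_def)
  qed
  then obtain x R where x: "\<And>n. x n \<in> K" and R: "\<And>n. 0 < R n" "\<And>n. R n \<le> \<epsilon> n"
    and fail: "\<And>n. \<not> shrinking_cover (s n) (\<epsilon> n) (1 - \<epsilon> n) K (x n) (R n)"
    by metis
  have "R \<longlonglongrightarrow> 0"
    using R by (intro tendsto_sandwich[OF _ _ tendsto_const \<epsilon>0]) (auto intro!: always_eventually less_imp_le)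
  then obtain F k where F: "F \<in> weak_tangents K" and k: "strict_mono (k :: nat \<Rightarrow> nat)"
    and lim: "(\<lambda>n. hausdorff_dist ((\<lambda>y. (1 / R (k n)) *\<^sub>R (y - x (k n))) ` K \<inter> cball 0 1) F) \<longlonglongrightarrow> 0"
    by (rule weak_tangent_subsequence[of K x R, OF K(1) x R(1)])
  have "F \<noteq> {}" "compact F" using F by (auto simp: weak_tangents_def)
  have "1 \<le> hausdorff_content \<alpha> F"
  proof (rule ccontr)
    assume "\<not> 1 \<le> hausdorff_content \<alpha> F"
    then have lt: "hausdorff_content \<alpha> F < 1" by simp
    have "0 < \<alpha>" using pos by (simp add: \<alpha>_def)
    obtain U and I :: "nat set" where I: "finite I"
      and U: "\<And>i. i \<in> I \<Longrightarrow> open (U i) \<and> bounded (U i) \<and> U i \<noteq> {}"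
      and FU: "F \<subseteq> (\<Union>i\<in>I. U i)" and sum: "(\<Sum>i\<in>I. diameter (U i) powr \<alpha>) < 1"
      using hausdorff_content_less_one_cover[OF \<open>compact F\<close> \<open>0 < \<alpha>\<close> lt] by metis
    have d0: "0 < diameter (U i)" if "i \<in> I" for i using U[OF that] diameter_open_pos by blast
    have d1: "diameter (U i) < 1" if "i \<in> I" for i
    proof (rule ccontr)
      assume "\<not> diameter (U i) < 1"
      then have "1 \<le> diameter (U i) powr \<alpha>" using \<open>0 < \<alpha>\<close> by (intro ge_one_powr_ge_zero) auto
      also have "\<dots> \<le> (\<Sum>i\<in>I. diameter (U i) powr \<alpha>)" using that I by (intro member_le_sum) auto
      finally show False using sum by simp
    qed
    have \<epsilon>k: "(\<lambda>n. \<epsilon> (k n)) \<longlonglongrightarrow> 0"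
      using LIMSEQ_subseq_LIMSEQ[OF \<epsilon>0 k] by (simp add: o_def)
    have "(\<lambda>n. s (k n)) \<longlonglongrightarrow> \<alpha> * (1 - 0)"
      unfolding s_def by (intro tendsto_intros \<epsilon>k)
    \<comment> \<open>Continuity in the exponent, with positive bases: the strict inequality at
      \<alpha> survives for the exponents \<open>s (k n)\<close> below it.\<close>
    then have "(\<lambda>n. \<Sum>i\<in>I. diameter (U i) powr s (k n)) \<longlonglongrightarrow> (\<Sum>i\<in>I. diameter (U i) powr \<alpha>)"
      using d0 by (intro tendsto_intros) fastforce+
    then have ev1: "\<forall>\<^sub>F n in sequentially. (\<Sum>i\<in>I. diameter (U i) powr s (k n)) < 1"
      using sum by (rule order_tendstoD)
    have ev2: "\<forall>\<^sub>F n in sequentially. \<forall>i\<in>I. \<epsilon> (k n) < diameter (U i) \<and> \<epsilon> (k n) < 1 - diameter (U i)"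
      using I d0 d1 order_tendstoD(2)[OF \<epsilon>k]
      by (intro eventually_ball_finite) (auto intro!: eventually_conj)
    \<comment> \<open>Openness of the cover gives room around the compact \<open>F\<close>, so the
      cover of \<open>F\<close> also covers every blow-up close enough to it.\<close>
    obtain e where "e > 0" and e: "{x. infdist x F \<le> e} \<subseteq> (\<Union>i\<in>I. U i)"
      using compact_in_open_separated[OF \<open>F \<noteq> {}\<close> \<open>compact F\<close> _ FU] U by (metis open_UN)
    have ev3: "\<forall>\<^sub>F n in sequentially.
        hausdorff_dist ((\<lambda>y. (1 / R (k n)) *\<^sub>R (y - x (k n))) ` K \<inter> cball 0 1) F < e"
      using lim \<open>e > 0\<close> by (rule order_tendstoD)
    have "\<forall>\<^sub>F n in sequentially. False"
      using ev1 ev2 ev3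
    proof eventually_elim
      case (elim n)
      have "shrinking_cover (s (k n)) (\<epsilon> (k n)) (1 - \<epsilon> (k n)) K (x (k n)) (R (k n))"
      proof (rule shrinking_cover_of_blow_up[OF I R(1)])
        show "(\<lambda>y. (1 / R (k n)) *\<^sub>R (y - x (k n))) ` K \<inter> cball 0 1 \<subseteq> (\<Union>i\<in>I. U i)"
        proof
          fix a assume a: "a \<in> (\<lambda>y. (1 / R (k n)) *\<^sub>R (y - x (k n))) ` K \<inter> cball 0 1"
          have "infdist a F \<le> e"
            using infdist_le_hausdorff_dist[OF a _ \<open>F \<noteq> {}\<close>] elim(3)
            by (simp add: bounded_Int)
          then show "a \<in> (\<Union>i\<in>I. U i)" using e by blast
        qed
      qed (use U elim in \<open>force+\<close>)
      then show ?case using fail by blast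
    qed
    then show False by simp
  qed
  then show ?thesis using F unfolding \<alpha>_def by blast
qed

section \<open>Existence of weak tangents and the case of dimension zero\<close>

lemma weak_tangents_nonempty:
  fixes K :: "'a::euclidean_space set"
  assumes "compact K" "K \<noteq> {}"
  shows "weak_tangents K \<noteq> {}"
proof -
  obtain p where "p \<in> K" using assms by blast
  have "(\<lambda>n. inverse (real (Suc n))) \<longlonglongrightarrow> 0" by (rule LIMSEQ_inverse_real_of_nat)
  then show ?thesis
    using weak_tangent_subsequence[OF assms(1), of "\<lambda>_. p" "\<lambda>n. inverse (real (Suc n))"] \<open>p \<in> K\<close>
    by auto
qed

theorem corollaryB:
  fixes K :: "(real ^ 'd) set" and \<alpha> :: real
  assumes "compact K" and "K \<noteq> {}"
    and "\<alpha> = assouad_dim K"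
  shows "\<exists>F\<in>weak_tangents K. hausdorff_content \<alpha> F \<ge> 1"
proof (cases "\<alpha> = 0")
  case True
  obtain F where "F \<in> weak_tangents K" using weak_tangents_nonempty assms by blast
  moreover have "F \<noteq> {}" using \<open>F \<in> weak_tangents K\<close> by (auto simp: weak_tangents_def)
  ultimately show ?thesis using hausdorff_content_zero True by blast
next
  case False
  then have "0 < assouad_dim K" using assms assouad_dim_nonneg[of K] by simp
  then show ?thesis using weak_tangent_large_content assms by blast
qed

end
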